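(* Let $n>k\ge 1$ be natural numbers and let $\epsilon>0$. Then there exists $b_0$ such that for all $b>b_0$ with $b>0$ and all real $a$ with $0<a<\left(\frac{n-k}{n+k}-\epsilon\right)b$, the function $$f(z)=z^n+az^k+b\overline{z}^k-1,\qquad z\in\mathbb{C},$$ has exactly $n+2k$ zeros in $\mathbb{C}$, counted with multiplicity.
   Context: Here $f=H+\overline{G}$ with analytic part $H(z)=z^n+az^k-1$ and co-analytic part $\overline{G(z)}$, $G(z)=bz^k$. The sense-preserving region of $f$ is $\{z: |H'(z)|>|G'(z)|\}$ and the sense-reversing region is $\{z: |H'(z)|<|G'(z)|\}$. The order of a zero $z_0$ of $f$ in the sense-preserving region is the smallest $m\ge 1$ with $H^{(m)}(z_0)\ne 0$; the order of a zero $z_0$ in the sense-reversing region is $-m$, where $m\ge1$ is the smallest integer with $G^{(m)}(z_0)\neq 0$. A zero is counted with multiplicity equal to the absolute value of its order. *)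

theory Defs
  imports "HOL-Analysis.Analysis"
begin

definition harmonic_fun :: "(complex \<Rightarrow> complex) \<Rightarrow> (complex \<Rightarrow> complex) \<Rightarrow> complex \<Rightarrow> complex" where
  "harmonic_fun H G z = H z + cnj (G z)"

definition sense_preserving_region :: "(complex \<Rightarrow> complex) \<Rightarrow> (complex \<Rightarrow> complex) \<Rightarrow> complex set" where
  "sense_preserving_region H G = {z. cmod (deriv H z) > cmod (deriv G z)}"

definition sense_reversing_region :: "(complex \<Rightarrow> complex) \<Rightarrow> (complex \<Rightarrow> complex) \<Rightarrow> complex set" where
  "sense_reversing_region H G = {z. cmod (deriv H z) < cmod (deriv G z)}"

text \<open>The order has no meaning at a singular point, that is, where the moduli of the two
  derivatives agree; its value there is left unspecified.\<close>

definition zero_order :: "(complex \<Rightarrow> complex) \<Rightarrow> (complex \<Rightarrow> complex) \<Rightarrow> complex \<Rightarrow> int" where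
  "zero_order H G z =
     (if z \<in> sense_preserving_region H G then int (LEAST m. 1 \<le> m \<and> (deriv ^^ m) H z \<noteq> 0)
      else if z \<in> sense_reversing_region H G then - int (LEAST m. 1 \<le> m \<and> (deriv ^^ m) G z \<noteq> 0)
      else undefined)"

definition harmonic_zeros :: "(complex \<Rightarrow> complex) \<Rightarrow> (complex \<Rightarrow> complex) \<Rightarrow> complex set" where
  "harmonic_zeros H G = {z. harmonic_fun H G z = 0}"

text \<open>A count with multiplicity makes sense only if every zero has an order, so the absence of
  singular zeros is part of the assertion, as is finiteness (a sum over an infinite set is 0).\<close>

definition has_zeros_with_multiplicity ::
    "(complex \<Rightarrow> complex) \<Rightarrow> (complex \<Rightarrow> complex) \<Rightarrow> nat \<Rightarrow> bool" where
  "has_zeros_with_multiplicity H G N \<longleftrightarrow>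
     finite (harmonic_zeros H G) \<and>
     harmonic_zeros H G \<subseteq> sense_preserving_region H G \<union> sense_reversing_region H G \<and>
     (\<Sum>z\<in>harmonic_zeros H G. \<bar>zero_order H G z\<bar>) = int N"

definition analytic_part :: "nat \<Rightarrow> nat \<Rightarrow> real \<Rightarrow> complex \<Rightarrow> complex" where
  "analytic_part n k a z = z ^ n + complex_of_real a * z ^ k - 1"

text \<open>The function whose conjugate is the co-analytic part.\<close>

definition coanalytic_part :: "nat \<Rightarrow> real \<Rightarrow> complex \<Rightarrow> complex" where
  "coanalytic_part k b z = complex_of_real b * z ^ k"

lemma harmonic_fun_trinomial:
  "harmonic_fun (analytic_part n k a) (coanalytic_part k b) z =
     z ^ n + complex_of_real a * z ^ k + complex_of_real b * cnj z ^ k - 1"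
  by (simp add: harmonic_fun_def analytic_part_def coanalytic_part_def)

end

theory Submission
  imports Defs
begin

text \<open>Every zero is nonsingular for large \<open>b\<close> and then has order \<open>1\<close> or \<open>- 1\<close>, so it suffices to find
  \<open>n + k\<close> zeros with \<open>\<bar>z\<bar> \<ge> 1\<close> and \<open>k\<close> zeros with \<open>\<bar>z\<bar> < 1\<close>. Put \<open>z = exp x\<close>.

  On \<open>\<bar>z\<bar> \<ge> 1\<close>, dividing by \<open>cnj z ^ k\<close> turns the equation into
  \<open>exp ((n - k) Re x + \<i> (n + k) Im x) = - b Q x\<close> with \<open>Q x = 1 + (a / b) exp (2 \<i> k Im x) + O(1 / b)\<close>.
  The right-hand side stays on one side of the imaginary axis, so its logarithm is single-valued, and
  each of the \<open>n + k\<close> branches is a fixed point problem for a map with Lipschitz constant about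
  \<open>2 k \<lambda> / ((1 - \<lambda>) (n - k))\<close>, where \<open>\<lambda> = a / b\<close>; this is below \<open>1\<close> precisely when
  \<open>\<lambda> < (n - k) / (n + k)\<close>. On \<open>\<bar>z\<bar> < 1\<close> the zeros are tiny, \<open>z\<^sup>n\<close> is a small perturbation, and the
  \<open>k\<close> branches of \<open>(a / b) w + cnj w = 1 - z\<^sup>n\<close>, \<open>w = b z\<^sup>k\<close>, are contractions as well.\<close>

section \<open>Lipschitz bounds for \<open>exp\<close> and \<open>Ln\<close>, and counting by
  contraction\<close>

lemma norm_exp_diff_le:
  fixes x y :: complex
  assumes "Re x \<le> c" "Re y \<le> c"
  shows "cmod (exp x - exp y) \<le> exp c * cmod (x - y)"
proof (rule field_differentiable_bound[where S = "{z. Re z \<le> c}" and f' = exp])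
  show "convex {z. Re z \<le> c}"
    using convex_halfspace_Re_le[of c] by simp
qed (use assms in \<open>auto intro!: derivative_eq_intros\<close>)

text \<open>The half-plane is convex and avoids the branch cut, and the derivative
  \<open>inverse z\<close> has modulus at most \<open>1 / m\<close> there, so the mean value
  inequality applies.\<close>

lemma norm_Ln_diff_le:
  fixes x y :: complex
  assumes "0 < m" "m \<le> Re x" "m \<le> Re y"
  shows "cmod (Ln x - Ln y) \<le> (1 / m) * cmod (x - y)"
proof (rule field_differentiable_bound[where S = "{z. m \<le> Re z}" and f' = inverse])
  show "convex {z. m \<le> Re z}"
    using convex_halfspace_Re_ge[of m] by simp
  show "(Ln has_field_derivative inverse z) (at z within {z. m \<le> Re z})"
    if "z \<in> {z. m \<le> Re z}" for z
  proof -
    have "z \<notin> \<real>\<^sub>\<le>\<^sub>0"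
      using that assms(1) by (auto simp: complex_nonpos_Reals_iff)
    then show ?thesis
      by (rule has_field_derivative_at_within[OF has_field_derivative_Ln])
  qed
  show "cmod (inverse z) \<le> 1 / m" if "z \<in> {z. m \<le> Re z}" for z
  proof -
    have "m \<le> cmod z"
      using that complex_Re_le_cmod[of z] by auto
    then show ?thesis
      using assms(1) by (simp add: norm_inverse le_imp_inverse_le flip: inverse_eq_divide)
  qed
qed (use assms in auto)

text \<open>Taking logarithms, each of the \<open>N\<close> branches of the equation becomes a fixed point problem
  for a contraction; branches whose index differs by a multiple of \<open>N\<close> give the same
  value of \<open>exp x\<close>.\<close>

lemma card_exp_solutions:
  fixes Q :: "complex \<Rightarrow> complex" and B :: complex and I :: "real set"
    and N :: nat and p m L :: real
  defines "S \<equiv> {x. Re x \<in> I \<and> exp (Complex (p * Re x) (real N * Im x)) = B * Q x}"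
  assumes I: "closed I" "I \<noteq> {}" and p: "0 < p" "p \<le> real N" and B: "B \<noteq> 0"
    and m: "0 < m" and Re_Q: "\<And>x. Re x \<in> I \<Longrightarrow> m \<le> Re (Q x)"
    and L: "0 \<le> L" "L < m * p"
    and lipschitz: "\<And>x y. Re x \<in> I \<Longrightarrow> Re y \<in> I \<Longrightarrow> cmod (Q x - Q y) \<le> L * cmod (x - y)"
    and self: "\<And>x. Re x \<in> I \<Longrightarrow> ln (cmod (B * Q x)) / p \<in> I"
    and periodic: "\<And>x t. Q (x + 2 * of_real pi * \<i> * of_int t) = Q x"
  shows "finite (exp ` S) \<and> card (exp ` S) = N"
proof -
  define D where "D = {x. Re x \<in> I}"
  \<comment> \<open>\<open>\<Phi>\<close> is the real-linear inverse of \<open>\<Psi>\<close>, so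
    the fixed points of \<open>T j\<close> are the solutions for which the logarithm of the
    right-hand side is taken on branch \<open>j\<close>.\<close>
  define \<Phi> where "\<Phi> w = Complex (Re w / p) (Im w / real N)" for w
  define \<Psi> where "\<Psi> w = Complex (p * Re w) (real N * Im w)" for w
  define T where "T j x = \<Phi> (Ln B + 2 * of_real pi * \<i> * of_int j + Ln (Q x))" for j :: int and x
  have N: "0 < real N" using p by linarith
  have fix_iff: "T j x = x \<longleftrightarrow> \<Psi> x = Ln B + 2 * of_real pi * \<i> * of_int j + Ln (Q x)" for j x
    using p N by (auto simp: T_def \<Phi>_def \<Psi>_def complex_eq_iff divide_simps mult.commute)
  have Q_nz: "Q x \<noteq> 0" if "x \<in> D" for x
    using Re_Q[of x] m that by (auto simp: D_def)
  \<comment> \<open>Since \<open>p \<le> real N\<close>, the real direction is the one that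
    \<open>\<Phi>\<close> shrinks least.\<close>
  have \<Phi>_norm: "cmod (\<Phi> w) \<le> cmod w / p" for w
  proof -
    have "(Im w / real N)\<^sup>2 \<le> (Im w / p)\<^sup>2"
      unfolding power_divide using p N by (intro divide_left_mono) (auto intro: power_mono)
    then have "(Re w / p)\<^sup>2 + (Im w / real N)\<^sup>2 \<le> (cmod w / p)\<^sup>2"
      by (simp add: power_divide cmod_power2 add_divide_distrib)
    then show ?thesis
      using p unfolding \<Phi>_def cmod_def by (auto intro!: real_le_lsqrt simp: cmod_def)
  qed
  have \<Phi>_diff: "\<Phi> v - \<Phi> w = \<Phi> (v - w)" for v w
    by (simp add: \<Phi>_def complex_eq_iff diff_divide_distrib)
  have ex1: "\<exists>!x. x \<in> D \<and> T j x = x" for j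
  proof -
    have "\<exists>!x\<in>D. T j x = x"
    proof (rule Banach_fix)
      have "D = Re -` I" by (auto simp: D_def)
      then show "complete D"
        using I(1) by (auto simp: complete_eq_closed intro!: closed_vimage continuous_intros)
      from I(2) obtain s where "s \<in> I" by auto
      then have "of_real s \<in> D" by (simp add: D_def)
      then show "D \<noteq> {}" by auto
      \<comment> \<open>The three factors are the Lipschitz constants of \<open>Q\<close>, of
        \<open>Ln\<close> on the half-plane containing the values of \<open>Q\<close>, and of
        \<open>\<Phi>\<close>.\<close>
      show "0 \<le> L / (m * p)" "L / (m * p) < 1"
        using L m p by auto
      show "T j ` D \<subseteq> D"
      proof (clarsimp simp: D_def)
        fix x assume x: "Re x \<in> I"
        then have "Q x \<noteq> 0" using Q_nz by (simp add: D_def)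
        \<comment> \<open>The branch term is purely imaginary, so the real part does not depend on
          \<open>j\<close> and \<open>self\<close> keeps every \<open>T j\<close> inside
          \<open>D\<close>.\<close>
        then have "Re (T j x) = ln (cmod (B * Q x)) / p"
          using B by (simp add: T_def \<Phi>_def norm_mult ln_mult)
        then show "Re (T j x) \<in> I" using self[OF x] by simp
      qed
      show "dist (T j x) (T j y) \<le> L / (m * p) * dist x y" if "x \<in> D" "y \<in> D" for x y
      proof -
        have x: "Re x \<in> I" "Re y \<in> I" using that by (auto simp: D_def)
        have "dist (T j x) (T j y) \<le> cmod (Ln (Q x) - Ln (Q y)) / p"
          using \<Phi>_norm[of "Ln (Q x) - Ln (Q y)"] by (simp add: dist_norm T_def \<Phi>_diff)
        also have "\<dots> \<le> (1 / m * cmod (Q x - Q y)) / p"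
          using p x by (intro divide_right_mono norm_Ln_diff_le m Re_Q) auto
        also have "\<dots> \<le> (1 / m * (L * cmod (x - y))) / p"
          using p m x by (intro divide_right_mono mult_left_mono lipschitz) auto
        finally show ?thesis by (simp add: dist_norm mult.commute)
      qed
    qed
    then show ?thesis by blast
  qed
  define X where "X j = (THE x. x \<in> D \<and> T j x = x)" for j
  have X: "X j \<in> D" "T j (X j) = X j" for j
    using theI'[OF ex1[of j]] by (auto simp: X_def)
  have X_eq: "X j = x" if "x \<in> D" "T j x = x" for j x
    using ex1[of j] X[of j] that by blast
  have S_iff: "x \<in> S \<longleftrightarrow> (\<exists>j. x \<in> D \<and> T j x = x)" for x
  proof -
    have "exp (\<Psi> x) = B * Q x \<longleftrightarrow> (\<exists>j. T j x = x)" if "x \<in> D"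
    proof -
      have "B * Q x = exp (Ln B + Ln (Q x))"
        using Q_nz[OF that] B by (simp add: exp_add)
      then show ?thesis
        unfolding fix_iff by (simp add: exp_eq algebra_simps)
    qed
    then show ?thesis by (auto simp: S_def D_def \<Psi>_def)
  qed
  \<comment> \<open>Translating \<open>x\<close> by \<open>2 pi i t\<close> leaves \<open>Q\<close>
    fixed but moves \<open>\<Psi> x\<close> by \<open>2 pi i N t\<close>, which the branch index
    must absorb.\<close>
  have shift: "T (j + int N * t) (x + 2 * of_real pi * \<i> * of_int t) = x + 2 * of_real pi * \<i> * of_int t
      \<longleftrightarrow> T j x = x" for j t x
    unfolding fix_iff periodic using N by (auto simp: \<Psi>_def complex_eq_iff algebra_simps)
  have "exp ` S = (\<lambda>j. exp (X (int j))) ` {..<N}"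
  proof (intro equalityI subsetI)
    fix z assume "z \<in> exp ` S"
    then obtain x j where x: "z = exp x" "x \<in> D" "T j x = x"
      using S_iff by blast
    \<comment> \<open>This translation reduces the branch index to its residue modulo
      \<open>N\<close> without changing \<open>exp x\<close>.\<close>
    define t where "t = - (j div int N)"
    have j: "j + int N * t = j mod int N"
      by (simp add: t_def minus_mult_div_eq_mod)
    have x': "x + 2 * of_real pi * \<i> * of_int t \<in> D"
      using x by (simp add: D_def)
    have "X (j mod int N) = x + 2 * of_real pi * \<i> * of_int t"
      using X_eq[OF x'] shift[of j t x] x j by simp
    then have "exp (X (int (nat (j mod int N)))) = z"
      using x N by (simp add: exp_eq)
    moreover have "nat (j mod int N) < N"
      using N by (simp add: nat_less_iff)
    ultimately show "z \<in> (\<lambda>j. exp (X (int j))) ` {..<N}" by blast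
  next
    fix z assume "z \<in> (\<lambda>j. exp (X (int j))) ` {..<N}"
    then show "z \<in> exp ` S" using S_iff X by blast
  qed
  moreover have "inj_on (\<lambda>j. exp (X (int j))) {..<N}"
  proof (rule inj_onI)
    fix i j assume ij: "i \<in> {..<N}" "j \<in> {..<N}" "exp (X (int i)) = exp (X (int j))"
    then obtain t where "X (int i) = X (int j) + of_int (2 * t) * pi * \<i>"
      unfolding exp_eq by blast
    then have t: "X (int i) = X (int j) + 2 * of_real pi * \<i> * of_int t"
      by (simp add: algebra_simps)
    \<comment> \<open>The point \<open>X (int i)\<close> is now fixed on two branches, but by
      \<open>fix_iff\<close> a point determines its branch index. Hence \<open>i\<close> and
      \<open>j\<close> agree modulo \<open>N\<close>.\<close>
    have "T (int j + int N * t) (X (int i)) = X (int i)"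
      using shift[of "int j" t "X (int j)"] X by (simp add: t)
    then have "2 * of_real pi * \<i> * of_int (int j + int N * t) = 2 * of_real pi * \<i> * (of_int (int i) :: complex)"
      using X(2)[of "int i"] unfolding fix_iff by (metis (no_types, lifting) add_left_cancel add_right_cancel)
    then have "of_int (int j + int N * t) = (of_int (int i) :: complex)"
      by simp
    then have "int j + int N * t = int i"
      unfolding of_int_eq_iff .
    then have "int i mod int N = int j mod int N"
      by (metis mod_mult_self2)
    then show "i = j" using ij by simp
  qed
  ultimately show ?thesis
    by (auto simp: card_image)
qed

section \<open>From multiplicities to cardinality\<close>

text \<open>A strict inequality between the moduli makes the larger derivative nonzero, and that is
  the derivative which defines the order, so the least index is already \<open>1\<close>.\<close>

lemma abs_zero_order_nonsingular:
  assumes "z \<in> sense_preserving_region H G \<union> sense_reversing_region H G"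
  shows "\<bar>zero_order H G z\<bar> = 1"
proof -
  have least: "(LEAST m. 1 \<le> m \<and> (deriv ^^ m) h z \<noteq> 0) = 1" if "deriv h z \<noteq> 0" for h
    by (rule Least_equality) (use that in auto)
  show ?thesis
  proof (cases "z \<in> sense_preserving_region H G")
    case True
    then have "deriv H z \<noteq> 0" by (auto simp: sense_preserving_region_def)
    from least[OF this] True show ?thesis by (simp add: zero_order_def)
  next
    case False
    with assms have rev: "z \<in> sense_reversing_region H G" by auto
    then have "deriv G z \<noteq> 0" by (auto simp: sense_reversing_region_def)
    from least[OF this] False rev show ?thesis by (simp add: zero_order_def)
  qed
qed

lemma has_zeros_with_multiplicityI:
  assumes "finite (harmonic_zeros H G)"
    and "harmonic_zeros H G \<subseteq> sense_preserving_region H G \<union> sense_reversing_region H G"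
    and "card (harmonic_zeros H G) = N"
  shows "has_zeros_with_multiplicity H G N"
proof -
  have "(\<Sum>z\<in>harmonic_zeros H G. \<bar>zero_order H G z\<bar>) = (\<Sum>z\<in>harmonic_zeros H G. 1)"
    using assms(2) by (intro sum.cong refl abs_zero_order_nonsingular) auto
  then show ?thesis
    using assms by (simp add: has_zeros_with_multiplicity_def)
qed

section \<open>Zeros outside the open unit disc\<close>

text \<open>The nonvanishing factor \<open>exp (of_nat k * cnj x)\<close> is split off. The
  remaining exponent \<open>n x - k cnj x\<close> has real part scaled by \<open>n - k\<close> and
  imaginary part by \<open>n + k\<close>, because conjugation reverses only the latter.\<close>

lemma trinomial_eq_exp:
  fixes a b :: real and n k :: nat
  assumes "b \<noteq> 0"
  shows "harmonic_fun (analytic_part n k a) (coanalytic_part k b) (exp x) = 0 \<longleftrightarrow>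
    exp (Complex ((real n - real k) * Re x) (real (n + k) * Im x)) =
      - of_real b * (1 + of_real (a / b) * exp (of_nat k * (x - cnj x)) - exp (- of_nat k * cnj x) / of_real b)"
proof -
  have eq: "Complex ((real n - real k) * Re x) (real (n + k) * Im x) = of_nat n * x - of_nat k * cnj x"
    by (simp add: complex_eq_iff algebra_simps)
  have "harmonic_fun (analytic_part n k a) (coanalytic_part k b) (exp x) =
      exp (of_nat n * x) + of_real a * exp (of_nat k * x) + of_real b * exp (of_nat k * cnj x) - 1"
    unfolding harmonic_fun_trinomial by (simp add: exp_of_nat_mult exp_cnj)
  also have "\<dots> = exp (of_nat k * cnj x) *
      (exp (of_nat n * x - of_nat k * cnj x) +
        of_real b * (1 + of_real (a / b) * exp (of_nat k * (x - cnj x)) - exp (- of_nat k * cnj x) / of_real b))"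
    using assms by (simp add: exp_diff exp_minus field_simps)
  finally show ?thesis
    unfolding eq by (simp add: eq_neg_iff_add_eq_0)
qed

text \<open>Instance of \<open>card_exp_solutions\<close> with \<open>p = n - k\<close>,
  \<open>N = n + k\<close>, \<open>B = - b\<close> and \<open>I = {0..}\<close>. The hypothesis
  \<open>contraction\<close> is the condition \<open>L < m * p\<close>.\<close>

lemma card_zeros_outside_unit_disc:
  fixes a b \<mu> :: real and n k :: nat
  assumes nk: "1 \<le> k" "k < n" and b: "0 < b" and a: "0 < a" "a \<le> \<mu> * b"
    and large: "2 < (1 - \<mu>) * b"
    and contraction: "2 * real k * \<mu> + real k / b < (1 - \<mu> - 1 / b) * (real n - real k)"
  defines "Z \<equiv> {z \<in> harmonic_zeros (analytic_part n k a) (coanalytic_part k b). 1 \<le> cmod z}"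
  shows "finite Z" "card Z = n + k"
proof -
  define l where "l = a / b"
  have l: "0 < l" "l \<le> \<mu>" using a b by (auto simp: l_def field_simps)
  define Q where "Q x = 1 + of_real l * exp (of_nat k * (x - cnj x)) - exp (- of_nat k * cnj x) / of_real b" for x
  define m where "m = 1 - \<mu> - 1 / b"
  have bm: "1 \<le> b * m" "0 < m"
  proof -
    \<comment> \<open>This lower bound on the modulus of \<open>b * Q x\<close> later makes its
      logarithm nonnegative, so that \<open>{0..}\<close> is preserved.\<close>
    show "1 \<le> b * m" using large b by (simp add: m_def algebra_simps)
    then show "0 < m" using b by (metis less_le_trans zero_less_mult_pos zero_less_one)
  qed
  have unit: "cmod (exp (of_nat k * (x - cnj x))) = 1" for x
    by simp
  have small: "cmod (exp (- of_nat k * cnj x)) \<le> 1" if "0 \<le> Re x" for x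
    using that by simp
  have Re_Q: "m \<le> Re (Q x)" if "Re x \<in> {0..}" for x
  proof -
    have "\<bar>Re (of_real l * exp (of_nat k * (x - cnj x)))\<bar> \<le> l"
      using abs_Re_le_cmod[of "of_real l * exp (of_nat k * (x - cnj x))"] l
      by (simp only: norm_mult unit) simp
    moreover have "\<bar>Re (exp (- of_nat k * cnj x) / of_real b)\<bar> \<le> 1 / b"
    proof -
      have "cmod (exp (- of_nat k * cnj x) / of_real b) \<le> 1 / b"
        unfolding norm_divide using small[of x] that b by (simp add: divide_right_mono)
      then show ?thesis using abs_Re_le_cmod order_trans by blast
    qed
    ultimately show ?thesis
      using l unfolding Q_def m_def minus_complex.sel plus_complex.sel one_complex.sel by linarith
  qed
  let ?S = "{x. Re x \<in> {0..} \<and> exp (Complex ((real n - real k) * Re x) (real (n + k) * Im x)) = - of_real b * Q x}"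
  have "Z = exp ` ?S"
  proof (intro equalityI subsetI)
    fix z assume z: "z \<in> Z"
    then have "z \<noteq> 0" by (auto simp: Z_def)
    then have "z = exp (Ln z)" "0 \<le> Re (Ln z)" using z by (auto simp: Z_def)
    moreover from this have "Ln z \<in> ?S"
      using z trinomial_eq_exp[of b n k a "Ln z"] b by (simp add: Z_def harmonic_zeros_def Q_def l_def)
    ultimately show "z \<in> exp ` ?S" by blast
  next
    fix z assume "z \<in> exp ` ?S"
    then obtain x where "z = exp x" "x \<in> ?S" by blast
    then show "z \<in> Z"
      using trinomial_eq_exp[of b n k a x] b by (simp add: Z_def harmonic_zeros_def Q_def l_def)
  qed
  moreover have "finite (exp ` ?S) \<and> card (exp ` ?S) = n + k"
  proof (rule card_exp_solutions[where m = m and L = "2 * real k * \<mu> + real k / b"])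
    show "2 * real k * \<mu> + real k / b < m * (real n - real k)"
      using contraction by (simp add: m_def)
    show "ln (cmod (- of_real b * Q x)) / (real n - real k) \<in> {0..}" if "Re x \<in> {0..}" for x
    proof -
      have "1 \<le> b * cmod (Q x)"
        using bm(1) b Re_Q[OF that] complex_Re_le_cmod[of "Q x"]
        by (meson less_imp_le mult_left_mono order_trans)
      then show ?thesis using nk b by (simp add: norm_mult)
    qed
    show "Q (x + 2 * of_real pi * \<i> * of_int t) = Q x" for x t
    proof -
      have "exp (of_nat k * (x + 2 * of_real pi * \<i> * of_int t - cnj (x + 2 * of_real pi * \<i> * of_int t)))
          = exp (of_nat k * (x - cnj x))"
        \<comment> \<open>Subtracting the conjugate doubles an imaginary shift, whence the factor
          \<open>2\<close> in the witness.\<close>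
        unfolding exp_eq by (intro exI[of _ "2 * int k * t"]) (simp add: algebra_simps)
      moreover have "exp (- of_nat k * cnj (x + 2 * of_real pi * \<i> * of_int t)) = exp (- of_nat k * cnj x)"
        unfolding exp_eq by (intro exI[of _ "int k * t"]) (simp add: algebra_simps)
      ultimately show ?thesis unfolding Q_def by metis
    qed
    show "cmod (Q x - Q y) \<le> (2 * real k * \<mu> + real k / b) * cmod (x - y)"
      if "Re x \<in> {0..}" "Re y \<in> {0..}" for x y
    proof -
      have "cmod (exp (of_nat k * (x - cnj x)) - exp (of_nat k * (y - cnj y)))
          \<le> exp 0 * cmod (of_nat k * (x - cnj x) - of_nat k * (y - cnj y))"
        by (rule norm_exp_diff_le) auto
      also have "of_nat k * (x - cnj x) - of_nat k * (y - cnj y) = of_nat k * ((x - y) - cnj (x - y))"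
        by (simp add: algebra_simps)
      \<comment> \<open>The factor \<open>2\<close> comes from bounding \<open>v - cnj v\<close> by
        \<open>2 * cmod v\<close>; it is the source of \<open>2 * real k * \<mu>\<close> in the
        Lipschitz constant.\<close>
      also have "exp 0 * cmod (of_nat k * ((x - y) - cnj (x - y))) \<le> real k * (2 * cmod (x - y))"
        using norm_triangle_ineq4[of "x - y" "cnj (x - y)"]
        unfolding norm_mult complex_mod_cnj by (simp add: mult_left_mono)
      finally have 1: "cmod (exp (of_nat k * (x - cnj x)) - exp (of_nat k * (y - cnj y))) \<le> real k * (2 * cmod (x - y))" .
      have "cmod (exp (- of_nat k * cnj x) - exp (- of_nat k * cnj y))
          \<le> exp 0 * cmod (- of_nat k * cnj x - (- of_nat k * cnj y))"
        using that by (intro norm_exp_diff_le) auto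
      also have "- of_nat k * cnj x - (- of_nat k * cnj y) = - of_nat k * cnj (x - y)"
        by (simp add: algebra_simps)
      finally have 2: "cmod (exp (- of_nat k * cnj x) - exp (- of_nat k * cnj y)) \<le> real k * cmod (x - y)"
        unfolding norm_mult complex_mod_cnj by simp
      have "Q x - Q y = of_real l * (exp (of_nat k * (x - cnj x)) - exp (of_nat k * (y - cnj y)))
          - (exp (- of_nat k * cnj x) - exp (- of_nat k * cnj y)) / of_real b"
        by (simp add: Q_def algebra_simps diff_divide_distrib)
      also have "cmod \<dots> \<le> l * cmod (exp (of_nat k * (x - cnj x)) - exp (of_nat k * (y - cnj y)))
          + cmod (exp (- of_nat k * cnj x) - exp (- of_nat k * cnj y)) / b"
        by (rule order_trans[OF norm_triangle_ineq4]) (use l b in \<open>simp only: norm_mult norm_divide norm_of_real abs_of_pos order.refl\<close>)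
      also have "\<dots> \<le> \<mu> * (real k * (2 * cmod (x - y))) + real k * cmod (x - y) / b"
        using 1 2 l b by (intro add_mono mult_mono divide_right_mono) auto
      finally show ?thesis by (simp add: algebra_simps)
    qed
  qed (use nk b l bm Re_Q in auto)
  ultimately show "finite Z" "card Z = n + k" by auto
qed

section \<open>Zeros inside the unit disc\<close>

text \<open>For \<open>0 < l < 1\<close> the real-linear equation \<open>l w + cnj w = v\<close> has
  the unique solution \<open>(cnj v - l v) / (1 - l^2)\<close>. With \<open>w = b z^k\<close> and
  \<open>v = 1 - z^n\<close> this gives \<open>exp (k x) = Q x / b\<close>, an instance of
  \<open>card_exp_solutions\<close> with \<open>p = N = k\<close>.\<close>

lemma card_zeros_inside_unit_disc:
  fixes a b \<mu> :: real and n k :: nat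
  assumes nk: "1 \<le> k" "k < n" and b: "0 < b" and a: "0 < a" "a \<le> \<mu> * b" and \<mu>: "\<mu> < 1"
    and large: "16 * real n \<le> (1 - \<mu>)\<^sup>2 * b"
  defines "Z \<equiv> {z \<in> harmonic_zeros (analytic_part n k a) (coanalytic_part k b). cmod z < 1}"
  shows "finite Z" "card Z = k"
proof -
  define l where "l = a / b"
  have l: "0 < l" "l \<le> \<mu>" using a b by (auto simp: l_def field_simps)
  then have l1: "l < 1" using \<mu> by simp
  note l = l l1
  \<comment> \<open>\<open>\<tau>\<close> will bound the modulus of \<open>z^n\<close>. It is chosen
    so that the Lipschitz constant \<open>n \<tau> / (1 - \<mu>)\<close> equals
    \<open>1 / 8\<close>, below the bound \<open>1 / 4\<close> for \<open>Re (Q x)\<close>;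
    \<open>large\<close> says that \<open>2 / ((1 - \<mu>) * b) \<le> \<tau>\<close>.\<close>
  define \<tau> where "\<tau> = (1 - \<mu>) / (8 * real n)"
  have \<tau>: "0 < \<tau>" "\<tau> < 1" "8 * real n * \<tau> = 1 - \<mu>" "\<tau> \<le> (1 - \<mu>) / 4"
  proof -
    show "0 < \<tau>" "8 * real n * \<tau> = 1 - \<mu>"
      using nk \<mu> by (auto simp: \<tau>_def)
    show "\<tau> \<le> (1 - \<mu>) / 4"
      unfolding \<tau>_def using nk \<mu> by (intro divide_left_mono) auto
    moreover have "(1 - \<mu>) / 4 < 1" using l by simp
    ultimately show "\<tau> < 1" by (rule le_less_trans)
  qed
  have \<tau>b: "2 / ((1 - \<mu>) * b) \<le> \<tau>"
    using large nk \<mu> b by (simp add: \<tau>_def field_simps power2_eq_square)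
  define q where "q x = exp (of_nat n * x)" for x :: complex
  define Q where "Q x = of_real (1 / (1 + l)) - (cnj (q x) - of_real l * q x) / of_real (1 - l\<^sup>2)" for x
  have l2: "1 - l\<^sup>2 = (1 - l) * (1 + l)" "0 < 1 - l\<^sup>2"
    using l by (auto simp: algebra_simps power2_eq_square abs_square_less_1[unfolded power2_eq_square])
  from l2(2) have nz: "of_real (1 - l\<^sup>2) \<noteq> (0 :: complex)"
    unfolding of_real_eq_0_iff by linarith
  \<comment> \<open>The solution operator has norm at most
    \<open>(1 + l) / (1 - l^2) = 1 / (1 - l)\<close>.\<close>
  have norm_le: "cmod ((cnj v - of_real l * v) / of_real (1 - l\<^sup>2)) \<le> cmod v / (1 - \<mu>)" for v
  proof -
    have "cmod (cnj v - of_real l * v) \<le> (1 + l) * cmod v"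
      using norm_triangle_ineq4[of "cnj v" "of_real l * v"] l by (simp add: norm_mult algebra_simps)
    then have "cmod ((cnj v - of_real l * v) / of_real (1 - l\<^sup>2)) \<le> (1 + l) * cmod v / (1 - l\<^sup>2)"
      using l2(2) by (simp only: norm_divide norm_of_real abs_of_pos divide_right_mono less_imp_le)
    also have "\<dots> = cmod v / (1 - l)"
      using l by (simp add: l2(1))
    also have "\<dots> \<le> cmod v / (1 - \<mu>)"
      using l \<mu> by (intro divide_left_mono) auto
    finally show ?thesis .
  qed
  have Q_alt: "Q x = (cnj (1 - q x) - of_real l * (1 - q x)) / of_real (1 - l\<^sup>2)" for x
  proof -
    have "(1 - l) / (1 - l\<^sup>2) = 1 / (1 + l)" using l by (simp add: l2(1))
    then have "of_real (1 / (1 + l)) = (1 - of_real l) / (of_real (1 - l\<^sup>2) :: complex)"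
      by (metis of_real_1 of_real_diff of_real_divide)
    then show ?thesis
      unfolding Q_def by (simp add: diff_divide_distrib[symmetric] algebra_simps)
  qed
  have zero_iff: "harmonic_fun (analytic_part n k a) (coanalytic_part k b) (exp x) = 0 \<longleftrightarrow>
      exp (Complex (real k * Re x) (real k * Im x)) = of_real (1 / b) * Q x" for x
  proof -
    define w where "w = of_real b * exp (of_nat k * x)"
    have lin: "of_real l * w + cnj w = v \<longleftrightarrow> w = (cnj v - of_real l * v) / of_real (1 - l\<^sup>2)" for v
    proof
      assume "of_real l * w + cnj w = v"
      then have "cnj v - of_real l * v = of_real (1 - l\<^sup>2) * w"
        by (auto simp: algebra_simps power2_eq_square)
      then show "w = (cnj v - of_real l * v) / of_real (1 - l\<^sup>2)"
        using nz by (metis nonzero_mult_div_cancel_left)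
    next
      assume w: "w = (cnj v - of_real l * v) / of_real (1 - l\<^sup>2)"
      have "of_real (1 - l\<^sup>2) * (of_real l * w + cnj w) = of_real (1 - l\<^sup>2) * v"
      proof -
        have w': "of_real (1 - l\<^sup>2) * w = cnj v - of_real l * v"
          unfolding w by (rule nonzero_mult_div_cancel_left[OF nz, unfolded times_divide_eq_right[symmetric]])
        then have "of_real (1 - l\<^sup>2) * cnj w = v - of_real l * cnj v"
          by (metis complex_cnj_cnj complex_cnj_complex_of_real complex_cnj_diff complex_cnj_mult)
        with w' show ?thesis
          by (simp only: distrib_left mult.left_commute[of _ "of_real l"])
             (simp add: algebra_simps power2_eq_square)
      qed
      then show "of_real l * w + cnj w = v" using nz by (simp only: mult_cancel_left) simp
    qed
    have "Complex (real k * Re x) (real k * Im x) = of_nat k * x"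
      by (simp add: complex_eq_iff)
    moreover have "exp (of_nat k * x) = of_real (1 / b) * Q x \<longleftrightarrow> w = Q x"
      using b by (auto simp: w_def field_simps)
    moreover have "harmonic_fun (analytic_part n k a) (coanalytic_part k b) (exp x) = of_real l * w + cnj w - (1 - q x)"
      unfolding harmonic_fun_trinomial w_def l_def q_def using b by (simp add: exp_of_nat_mult exp_cnj)
    ultimately show ?thesis using lin[of "1 - q x"] by (simp add: Q_alt)
  qed
  let ?I = "{..ln \<tau> / real n}"
  have q_le: "cmod (q x) \<le> \<tau> \<longleftrightarrow> Re x \<in> ?I" for x
  proof -
    have "cmod (q x) = exp (real n * Re x)" by (simp add: q_def)
    also have "\<dots> \<le> \<tau> \<longleftrightarrow> real n * Re x \<le> ln \<tau>"
      using \<tau> by (metis exp_le_cancel_iff exp_ln)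
    finally show ?thesis using nk by (simp add: field_simps)
  qed
  \<comment> \<open>The main term \<open>1 / (1 + l)\<close> is at least \<open>1 / 2\<close> and
    the perturbation has modulus at most \<open>1 / 4\<close>.\<close>
  have Re_Q: "1 / 4 \<le> Re (Q x)" if "Re x \<in> ?I" for x
  proof -
    have "cmod ((cnj (q x) - of_real l * q x) / of_real (1 - l\<^sup>2)) \<le> cmod (q x) / (1 - \<mu>)"
      by (rule norm_le)
    also have "\<dots> \<le> ((1 - \<mu>) / 4) / (1 - \<mu>)"
      using \<mu> \<tau> q_le[of x] that by (intro divide_right_mono) auto
    also have "\<dots> = 1 / 4" using \<mu> by simp
    finally have "Re ((cnj (q x) - of_real l * q x) / of_real (1 - l\<^sup>2)) \<le> 1 / 4"
      using complex_Re_le_cmod order_trans by blast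
    moreover have "1 / 2 \<le> 1 / (1 + l)" using l by (simp add: field_simps)
    ultimately show ?thesis unfolding Q_def minus_complex.sel Re_complex_of_real by linarith
  qed
  let ?S = "{x. Re x \<in> ?I \<and> exp (Complex (real k * Re x) (real k * Im x)) = of_real (1 / b) * Q x}"
  have "Z = exp ` ?S"
  proof (intro equalityI subsetI)
    fix z assume z: "z \<in> Z"
    then have zero: "z ^ n + of_real a * z ^ k + of_real b * cnj z ^ k - 1 = 0" and z1: "cmod z < 1"
      by (auto simp: Z_def harmonic_zeros_def harmonic_fun_trinomial)
    have "z \<noteq> 0" using zero nk by (auto simp: power_0_left)
    define r where "r = cmod z"
    have r: "0 \<le> r" "r < 1" using z1 by (auto simp: r_def)
    \<comment> \<open>A priori bound: isolating the conjugate term gives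
      \<open>b r^k \<le> 2 + \<mu> b r^k\<close>, so every zero in the open unit disc already lies
      in the smaller disc where \<open>r^n \<le> \<tau>\<close>.\<close>
    have "b * r ^ k = cmod (1 - z ^ n - of_real a * z ^ k)"
    proof -
      have "1 - z ^ n - of_real a * z ^ k = of_real b * cnj z ^ k" using zero by (simp add: algebra_simps)
      then show ?thesis using b by (simp add: r_def norm_mult norm_power)
    qed
    also have "\<dots> \<le> 1 + r ^ n + a * r ^ k"
      using norm_triangle_ineq4[of "1 - z ^ n" "of_real a * z ^ k"] norm_triangle_ineq4[of 1 "z ^ n"] a
      by (simp add: r_def norm_mult norm_power)
    also have "\<dots> \<le> 2 + (\<mu> * b) * r ^ k"
      using r a(2) by (intro add_mono mult_right_mono) (auto simp: power_le_one)
    finally have "r ^ k \<le> 2 / ((1 - \<mu>) * b)"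
      using \<mu> b by (simp add: field_simps)
    moreover have "r ^ n \<le> r ^ k"
      using r nk by (intro power_decreasing) auto
    ultimately have "r ^ n \<le> \<tau>" using \<tau>b by linarith
    moreover have "q (Ln z) = z ^ n"
      using \<open>z \<noteq> 0\<close> by (simp add: q_def exp_of_nat_mult)
    ultimately have "Re (Ln z) \<in> ?I"
      using q_le[of "Ln z"] by (simp only: norm_power r_def)
    moreover have "z = exp (Ln z)" using \<open>z \<noteq> 0\<close> by simp
    ultimately have "Ln z \<in> ?S"
      using z zero_iff[of "Ln z"] by (auto simp: Z_def harmonic_zeros_def)
    then show "z \<in> exp ` ?S" using \<open>z = exp (Ln z)\<close> by blast
  next
    fix z assume "z \<in> exp ` ?S"
    then obtain x where x: "z = exp x" "x \<in> ?S" by blast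
    have "ln \<tau> / real n < 0" using \<tau> nk by (simp add: divide_less_0_iff)
    then have "Re x < 0" using x by auto
    then show "z \<in> Z" using x zero_iff[of x] by (simp add: Z_def harmonic_zeros_def)
  qed
  moreover have "finite (exp ` ?S) \<and> card (exp ` ?S) = k"
  proof (rule card_exp_solutions[where m = "1 / 4" and L = "real n * \<tau> / (1 - \<mu>)"])
    have "real n * \<tau> / (1 - \<mu>) = 1 / 8"
      using \<tau>(3) \<mu> by (simp add: field_simps)
    then show "0 \<le> real n * \<tau> / (1 - \<mu>)" "real n * \<tau> / (1 - \<mu>) < 1 / 4 * real k"
      using nk by auto
    show "ln (cmod (of_real (1 / b) * Q x)) / real k \<in> ?I" if "Re x \<in> ?I" for x
    proof -
      have "cmod (Q x) \<le> cmod (1 - q x) / (1 - \<mu>)"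
        unfolding Q_alt by (rule norm_le)
      also have "\<dots> \<le> 2 / (1 - \<mu>)"
        using norm_triangle_ineq4[of 1 "q x"] q_le[of x] that \<tau> \<mu> by (intro divide_right_mono) auto
      finally have "cmod (Q x) / b \<le> (2 / (1 - \<mu>)) / b"
        using b by (intro divide_right_mono) auto
      then have "cmod (of_real (1 / b) * Q x) \<le> \<tau>"
        using \<tau>b b by (simp add: norm_mult norm_divide)
      then have "ln (cmod (of_real (1 / b) * Q x)) \<le> ln \<tau>"
        using b \<tau>(1) Re_Q[OF that] by (intro ln_mono) auto
      then have "ln (cmod (of_real (1 / b) * Q x)) / real k \<le> ln \<tau> / real k"
        by (simp add: divide_right_mono)
      \<comment> \<open>Here \<open>ln \<tau>\<close> is negative, so the larger denominator gives
        the larger quotient.\<close>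
      also have "\<dots> \<le> ln \<tau> / real n"
        using \<tau> nk by (intro divide_left_mono_neg) auto
      finally show ?thesis by simp
    qed
    show "Q (x + 2 * of_real pi * \<i> * of_int t) = Q x" for x t
    proof -
      have "q (x + 2 * of_real pi * \<i> * of_int t) = q x"
        unfolding q_def exp_eq by (intro exI[of _ "int n * t"]) (simp add: algebra_simps)
      then show ?thesis unfolding Q_def by simp
    qed
    show "cmod (Q x - Q y) \<le> real n * \<tau> / (1 - \<mu>) * cmod (x - y)"
      if "Re x \<in> ?I" "Re y \<in> ?I" for x y
    proof -
      have "Q x - Q y = (cnj (q y - q x) - of_real l * (q y - q x)) / of_real (1 - l\<^sup>2)"
        unfolding Q_def by (simp add: diff_divide_distrib[symmetric] algebra_simps)
      also have "cmod \<dots> \<le> cmod (q y - q x) / (1 - \<mu>)"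
        by (rule norm_le)
      also have "cmod (q y - q x) \<le> exp (ln \<tau>) * cmod (of_nat n * y - of_nat n * x)"
        unfolding q_def using that nk by (intro norm_exp_diff_le) (auto simp: field_simps)
      also have "\<dots> = real n * \<tau> * cmod (x - y)"
        using \<tau> by (simp add: right_diff_distrib[symmetric] norm_mult norm_minus_commute)
      finally show ?thesis using \<mu> by (simp add: divide_right_mono)
    qed
  qed (use nk b Re_Q in auto)
  ultimately show "finite Z" "card Z = k" by auto
qed

section \<open>Absence of singular zeros\<close>

text \<open>Multiplying both derivatives by \<open>z\<close> makes them comparable with the terms of
  the equation. The analytic derivative dominates when \<open>1 \<le> cmod z\<close>, the
  co-analytic one when \<open>cmod z < 1\<close>.\<close>

lemma zero_nonsingular:
  fixes a b \<mu> :: real and n k :: nat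
  assumes nk: "1 \<le> k" "k < n" and b: "0 < b" and a: "0 < a" "a \<le> \<mu> * b"
    and large: "real n < (1 - \<mu>) * b"
    and z: "z \<in> harmonic_zeros (analytic_part n k a) (coanalytic_part k b)"
  shows "z \<in> sense_preserving_region (analytic_part n k a) (coanalytic_part k b)
    \<union> sense_reversing_region (analytic_part n k a) (coanalytic_part k b)"
proof -
  have zero: "z ^ n + of_real a * z ^ k + of_real b * cnj z ^ k - 1 = 0"
    using z by (auto simp: harmonic_zeros_def harmonic_fun_trinomial)
  have "z \<noteq> 0" using zero nk by (auto simp: power_0_left)
  define r where "r = cmod z"
  have r: "0 < r" using \<open>z \<noteq> 0\<close> by (simp add: r_def)
  have dH: "deriv (analytic_part n k a) z = of_nat n * z ^ (n - 1) + of_real a * (of_nat k * z ^ (k - 1))"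
    unfolding analytic_part_def[abs_def] by (rule DERIV_imp_deriv) (auto intro!: derivative_eq_intros)
  have dG: "deriv (coanalytic_part k b) z = of_real b * (of_nat k * z ^ (k - 1))"
    unfolding coanalytic_part_def[abs_def] by (rule DERIV_imp_deriv) (auto intro!: derivative_eq_intros)
  have pw: "z * z ^ (n - 1) = z ^ n" "z * z ^ (k - 1) = z ^ k"
    using nk by (simp_all add: power_eq_if)
  have H: "r * cmod (deriv (analytic_part n k a) z) = cmod (of_nat n * z ^ n + of_real (a * real k) * z ^ k)"
  proof -
    have "z * deriv (analytic_part n k a) z = of_nat n * z ^ n + of_real (a * real k) * z ^ k"
      unfolding dH pw[symmetric] by (simp add: algebra_simps)
    then show ?thesis
      unfolding r_def norm_mult[symmetric] by simp
  qed
  have G: "r * cmod (deriv (coanalytic_part k b) z) = b * real k * r ^ k"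
  proof -
    have "z * deriv (coanalytic_part k b) z = of_real b * of_nat k * z ^ k"
      unfolding dG pw(2)[symmetric] by simp
    then have "r * cmod (deriv (coanalytic_part k b) z) = cmod (of_real b * of_nat k * z ^ k)"
      unfolding r_def norm_mult[symmetric] by simp
    then show ?thesis using b by (simp add: norm_mult norm_power r_def)
  qed
  have ba: "real n < b - a" using large a by (simp add: algebra_simps)
  have "r * cmod (deriv (analytic_part n k a) z) \<noteq> r * cmod (deriv (coanalytic_part k b) z)"
  proof (cases "1 \<le> r")
    case True
    \<comment> \<open>The equation is used to eliminate \<open>z^n\<close>, leaving
      \<open>n b cnj z^k\<close> as dominant term against \<open>k b r^k\<close> from the other
      derivative; the surplus is \<open>(n - k) (b - a) r^k - n\<close>.\<close>
    have "of_nat n * z ^ n + of_real (a * real k) * z ^ k =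
        of_nat n - (of_real ((real n - real k) * a) * z ^ k) - of_real (real n * b) * cnj z ^ k"
    proof -
      have "of_real b * cnj z ^ k = 1 - z ^ n - of_real a * z ^ k"
        using zero by (simp add: algebra_simps)
      then have "of_real (real n * b) * cnj z ^ k = of_nat n * (1 - z ^ n - of_real a * z ^ k)"
        by simp
      then show ?thesis by (simp add: algebra_simps)
    qed
    then have eq: "of_real (real n * b) * cnj z ^ k =
        of_nat n - of_real ((real n - real k) * a) * z ^ k - (of_nat n * z ^ n + of_real (a * real k) * z ^ k)"
      by (simp add: algebra_simps)
    have "cmod (of_real (real n * b) * cnj z ^ k) \<le>
        real n + cmod (of_real ((real n - real k) * a) * z ^ k) + r * cmod (deriv (analytic_part n k a) z)"
      unfolding eq H using norm_triangle_ineq4[of "of_nat n" "of_real ((real n - real k) * a) * z ^ k"]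
      by (intro order_trans[OF norm_triangle_ineq4] add_right_mono) simp
    then have "real n * b * r ^ k \<le> r * cmod (deriv (analytic_part n k a) z) + real n + (real n - real k) * a * r ^ k"
      using a b nk unfolding norm_mult norm_of_real norm_power complex_mod_cnj r_def by (simp add: abs_mult)
    moreover have "real n < (b - a) * r ^ k * (real n - real k)"
    proof -
      have "1 \<le> r ^ k" "1 \<le> real n - real k" using True nk by auto
      then have "(b - a) * 1 * 1 \<le> (b - a) * r ^ k * (real n - real k)"
        using ba by (intro mult_mono) auto
      then show ?thesis unfolding mult_1_right by (rule less_le_trans[OF ba])
    qed
    ultimately show ?thesis unfolding G by (simp add: algebra_simps)
  next
    case False
    have "r * cmod (deriv (analytic_part n k a) z) \<le> real n * r ^ n + a * real k * r ^ k"
      unfolding H using norm_triangle_ineq[of "of_nat n * z ^ n" "of_real (a * real k) * z ^ k"] a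
      by (simp add: norm_mult norm_power r_def)
    moreover have "real n * r ^ n < (b - a) * real k * r ^ k"
    proof -
      have "r ^ n \<le> r ^ k" using False r nk by (intro power_decreasing) auto
      then have "real n * r ^ n \<le> real n * r ^ k" by (simp add: mult_left_mono)
      also have "\<dots> < (b - a) * r ^ k" using ba r by simp
      also have "\<dots> \<le> (b - a) * real k * r ^ k"
        using ba r nk by (intro mult_right_mono) (auto simp: mult_le_cancel_left1)
      finally show ?thesis .
    qed
    ultimately show ?thesis unfolding G by (simp add: algebra_simps)
  qed
  then show ?thesis
    by (auto simp: sense_preserving_region_def sense_reversing_region_def)
qed

section \<open>Choice of the threshold and assembly\<close>

theorem theorem1p1:
  fixes n k :: nat and \<epsilon> :: real
  assumes "1 \<le> k" and "k < n" and "\<epsilon> > 0"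
  shows "\<exists>b0::real. \<forall>b::real. b > b0 \<and> b > 0 \<longrightarrow>
           (\<forall>a::real. 0 < a \<and> a < ((real n - real k) / (real n + real k) - \<epsilon>) * b \<longrightarrow>
              has_zeros_with_multiplicity (analytic_part n k a) (coanalytic_part k b) (n + 2 * k))"
proof -
  define \<mu> where "\<mu> = (real n - real k) / (real n + real k) - \<epsilon>"
  have "(real n - real k) / (real n + real k) < 1"
    using assms by (simp add: field_simps)
  then have \<mu>: "\<mu> < 1" using assms unfolding \<mu>_def by linarith
  \<comment> \<open>The first entry supplies \<open>large\<close> for the inner zeros, the second
    the contraction condition for the outer ones.\<close>
  define b0 where "b0 = max (16 * real n / (1 - \<mu>)\<^sup>2) (real n / (\<epsilon> * (real n + real k)))"
  have "has_zeros_with_multiplicity (analytic_part n k a) (coanalytic_part k b) (n + 2 * k)"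
    if b: "b0 < b" "0 < b" and a: "0 < a" "a < \<mu> * b" for a b
  proof -
    let ?H = "analytic_part n k a" and ?G = "coanalytic_part k b"
    \<comment> \<open>If \<open>\<epsilon>\<close> is so large that \<open>\<mu> \<le> 0\<close>, no
      admissible \<open>a\<close> exists.\<close>
    have "0 < \<mu>" using a b by (meson less_trans zero_less_mult_pos2)
    have b1: "16 * real n \<le> (1 - \<mu>)\<^sup>2 * b"
      using b \<mu> by (simp add: b0_def field_simps)
    have b2: "real n / b < \<epsilon> * (real n + real k)"
    proof -
      have "0 < \<epsilon> * (real n + real k)" using assms by simp
      moreover have "real n / (\<epsilon> * (real n + real k)) < b" using b by (simp add: b0_def)
      ultimately show ?thesis
        using b(2) by (simp only: pos_divide_less_eq mult.commute)
    qed
    have "(1 - \<mu>)\<^sup>2 \<le> 1 - \<mu>"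
      using \<open>0 < \<mu>\<close> \<mu> by (simp add: power2_eq_square mult_le_cancel_left1)
    then have "(1 - \<mu>)\<^sup>2 * b \<le> (1 - \<mu>) * b"
      using b by (intro mult_right_mono) auto
    then have b3: "16 * real n \<le> (1 - \<mu>) * b" using b1 by linarith
    \<comment> \<open>The right-hand side exceeds the left by exactly
      \<open>\<epsilon> (n + k) - n / b\<close>, which \<open>b2\<close> makes positive.\<close>
    have contraction: "2 * real k * \<mu> + real k / b < (1 - \<mu> - 1 / b) * (real n - real k)"
    proof -
      have "\<mu> * (real n + real k) = (real n - real k) - \<epsilon> * (real n + real k)"
        using assms unfolding \<mu>_def left_diff_distrib[of _ \<epsilon>] by simp
      then have "(1 - \<mu>) * (real n - real k) - 2 * real k * \<mu> = \<epsilon> * (real n + real k)"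
        by (simp add: algebra_simps)
      moreover have "real k / b + 1 / b * (real n - real k) = real n / b"
        by (simp add: diff_divide_distrib)
      ultimately show ?thesis using b2 by (simp add: algebra_simps)
    qed
    let ?L = "{z \<in> harmonic_zeros ?H ?G. 1 \<le> cmod z}" and ?S = "{z \<in> harmonic_zeros ?H ?G. cmod z < 1}"
    have L: "finite ?L" "card ?L = n + k"
      by (rule card_zeros_outside_unit_disc[where \<mu> = \<mu>]; use assms a b b3 contraction in linarith)+
    have S: "finite ?S" "card ?S = k"
      by (rule card_zeros_inside_unit_disc[where \<mu> = \<mu>]; use assms a b b1 \<mu> in linarith)+
    have union: "harmonic_zeros ?H ?G = ?L \<union> ?S" by auto
    have "finite (?L \<union> ?S)" "card (?L \<union> ?S) = n + 2 * k"
      using L S by (auto simp: card_Un_disjoint disjoint_iff)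
    then have "finite (harmonic_zeros ?H ?G)" "card (harmonic_zeros ?H ?G) = n + 2 * k"
      unfolding union[symmetric] .
    moreover have "z \<in> sense_preserving_region ?H ?G \<union> sense_reversing_region ?H ?G"
      if "z \<in> harmonic_zeros ?H ?G" for z
      by (rule zero_nonsingular[where \<mu> = \<mu>]) (use assms a b b3 that in auto)
    ultimately show ?thesis
      by (intro has_zeros_with_multiplicityI subsetI)
  qed
  then show ?thesis unfolding \<mu>_def by blast
qed

end
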